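(* Let $(\mathcal X,\mathcal B,\mathbb P,f)$ be as in the context, and assume that the system has decay of correlations of observables in a Banach space $\mathcal C$ against observables in $L^1(\mathbb P)$ with rate function $\gamma:\mathbb N\to\mathbb R$, and that there exists $\delta>0$ such that $n^{1+\delta}\gamma(n)\to0$ as $n\to\infty$. Fix $\zeta\in\mathcal X$ (satisfying the regularity assumptions in the context) and assume that there exists $q\in\mathbb N_0$ given by $$q:=\min\left\{j\in\mathbb N_0:\lim_{\varepsilon\to0}R(A_\varepsilon^{(j)}(\zeta))=\infty\right\}.$$ Write $A_\varepsilon:=A_\varepsilon^{(q)}(\zeta)$, and assume that $\mathbf 1_{A_\varepsilon}\in\mathcal C$ and that there exists $M>0$ such that $\|\mathbf 1_{A_\varepsilon}\|_{\mathcal C}\le M$ for all $\varepsilon>0$. Let $\theta=\lim_{\varepsilon\to0}\mathbb P(A_\varepsilon)/\mathbb P(B_\varepsilon(\zeta))$. Then $$-\lim_{\varepsilon\to0}\frac1{\mathbb P(B_\varepsilon(\zeta))}\limsup_{t\to\infty}\frac1t\log\mathbb P\left(r_{B_\varepsilon(\zeta)}>t\right)\ge\theta.$$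
   Context: $\mathbb N=\{1,2,\ldots\}$, $\mathbb N_0=\mathbb N\cup\{0\}$. $\mathcal X$ is a Riemannian manifold (with a given metric), $\mathcal B$ its Borel $\sigma$-algebra, $f:\mathcal X\to\mathcal X$ measurable, and $\mathbb P$ an $f$-invariant probability measure on $\mathcal B$. $f^{-i}$ denotes preimage under $f^i$; $\mathbf 1_A$ is the indicator function of $A$; $\log 0=-\infty$. Decay of correlations against $L^1$: $\mathcal C$ is a Banach space of real-valued measurable functions on $\mathcal X$ and $\gamma:\mathbb N\to\mathbb R$ is a non-increasing function with $\gamma(n)\to0$ such that for all nonzero $\phi\in\mathcal C$, $\psi\in L^1(\mathbb P)$ and all $n\in\mathbb N$, $$\frac{1}{\|\phi\|_{\mathcal C}\|\psi\|_{1}}\left|\int\phi\,(\psi\circ f^n)\,d\mathbb P-\int\phi\,d\mathbb P\int\psi\,d\mathbb P\right|\le\gamma(n).$$ $B_\varepsilon(\zeta)$ is the open ball of radius $\varepsilon$ around $\zeta$; $A_\varepsilon^{(0)}(\zeta)=B_\varepsilon(\zeta)$ and, for $j\ge1$, $A_\varepsilon^{(j)}(\zeta)=B_\varepsilon(\zeta)\cap\bigcap_{i=1}^jf^{-i}\left(B_\varepsilon(\zeta)^c\right)$. First hitting/return time: for $A\in\mathcal B$, $r_A(x)=\min\{j\in\mathbb N\cup\{+\infty\}:f^j(x)\in A\}$ ($=+\infty$ if the orbit never enters $A$ at a positive time), and $R(A)=\inf_{x\in A}r_A(x)$. Regularity assumptions at $\zeta$: $\mathbb P(B_\varepsilon(\zeta))>0$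 for $\varepsilon>0$, and $\varepsilon\mapsto\mathbb P(B_\varepsilon(\zeta))$ is continuous near $0$ with $\mathbb P(B_\varepsilon(\zeta))\to0$ as $\varepsilon\to0$. If $\zeta$ is periodic of prime period $p$ (i.e. $f^p(\zeta)=\zeta$ and $f^j(\zeta)\neq\zeta$ for $1\le j\le p-1$), then for all small $\varepsilon$: $B_\varepsilon(\zeta)\cap f^{-p}(B_\varepsilon(\zeta))\ne\emptyset$; $B_\varepsilon(\zeta)\cap f^{-j}(B_\varepsilon(\zeta))=\emptyset$ for $j=1,\ldots,p-1$; $\bigcap_{k\ge0}f^{-kp}(B_\varepsilon(\zeta))=\{\zeta\}$; and there is $0<\theta<1$ with $\mathbb P(B_\varepsilon(\zeta)\cap f^{-p}(B_\varepsilon(\zeta)))\sim(1-\theta)\mathbb P(B_\varepsilon(\zeta))$ as $\varepsilon\to0$. The limit defining $\theta$ in the claim is supposed to exist. *)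

theory Defs
  imports "HOL-Analysis.Analysis" "HOL-Probability.Probability"
begin

section \<open>Riemannian manifolds\<close>

text \<open>
  On an open subset of a finite-dimensional space, a map is of class \<open>C\<^sup>k\<^sup>+\<^sup>1\<close> iff it is
  differentiable and all its directional derivatives are of class \<open>C\<^sup>k\<close>.
\<close>

primrec C_k_on ::
    "nat \<Rightarrow> 'e::euclidean_space set \<Rightarrow> ('e \<Rightarrow> 'b::real_normed_vector) \<Rightarrow> bool" where
  "C_k_on 0 S h \<longleftrightarrow> continuous_on S h"
| "C_k_on (Suc k) S h \<longleftrightarrow>
     (\<forall>u\<in>S. h differentiable (at u)) \<and>
     (\<forall>v. C_k_on k S (\<lambda>u. frechet_derivative h (at u) v))"

definition smooth_on :: "'e::euclidean_space set \<Rightarrow> ('e \<Rightarrow> 'b::real_normed_vector) \<Rightarrow> bool" where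
  "smooth_on S h \<longleftrightarrow> (\<forall>k. C_k_on k S h)"

type_synonym ('a, 'e) chart = "'a set \<times> ('a \<Rightarrow> 'e)"

type_synonym ('a, 'e) metric_tensor = "('a, 'e) chart \<Rightarrow> 'e \<Rightarrow> 'e \<Rightarrow> 'e \<Rightarrow> real"

definition coords :: "('a, 'e) chart \<Rightarrow> 'e set" where
  "coords c = snd c ` fst c"

definition transition :: "('a, 'e) chart \<Rightarrow> ('a, 'e) chart \<Rightarrow> 'e \<Rightarrow> 'e" where
  "transition c d = snd d \<circ> inv_into (fst c) (snd c)"

text \<open>
  The underlying set of the manifold is the whole type \<open>'a\<close>, and its dimension is that of \<open>'e\<close>.
  It is not assumed to be connected. The metric is given by its local expressions:
  \<open>g c u v w\<close> is the inner product of the tangent vectors with coordinates \<open>v\<close> and \<open>w\<close> in the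
  chart \<open>c\<close>, at the point whose coordinates in \<open>c\<close> are \<open>u\<close>.
\<close>

locale riemannian_manifold =
  fixes atlas :: "('a::{t2_space, second_countable_topology}, 'e::euclidean_space) chart set"
    and g :: "('a, 'e) metric_tensor"
  assumes domain_open: "c \<in> atlas \<Longrightarrow> open (fst c)"
    and coords_open: "c \<in> atlas \<Longrightarrow> open (coords c)"
    and chart_homeomorphism: "c \<in> atlas \<Longrightarrow> \<exists>\<psi>. homeomorphism (fst c) (coords c) (snd c) \<psi>"
    and atlas_covers: "(\<Union>c\<in>atlas. fst c) = UNIV"
    and transition_smooth:
      "c \<in> atlas \<Longrightarrow> d \<in> atlas \<Longrightarrow> smooth_on (snd c ` (fst c \<inter> fst d)) (transition c d)"
    and metric_bilinear: "c \<in> atlas \<Longrightarrow> u \<in> coords c \<Longrightarrow> bilinear (g c u)"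
    and metric_symmetric: "c \<in> atlas \<Longrightarrow> u \<in> coords c \<Longrightarrow> g c u v w = g c u w v"
    and metric_positive: "c \<in> atlas \<Longrightarrow> u \<in> coords c \<Longrightarrow> v \<noteq> 0 \<Longrightarrow> g c u v v > 0"
    and metric_smooth: "c \<in> atlas \<Longrightarrow> smooth_on (coords c) (\<lambda>u. g c u v w)"
    and metric_compatible:
      "c \<in> atlas \<Longrightarrow> d \<in> atlas \<Longrightarrow> u \<in> snd c ` (fst c \<inter> fst d) \<Longrightarrow>
       g c u v w =
         g d (transition c d u)
           (frechet_derivative (transition c d) (at u) v)
           (frechet_derivative (transition c d) (at u) w)"

text \<open>
  \<open>curve_length atlas g x y l\<close> says that some piecewise \<open>C\<^sup>1\<close> curve from \<open>x\<close> to \<open>y\<close> has length \<open>l\<close>.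
  By compactness every such curve is a finite concatenation of \<open>C\<^sup>1\<close> arcs that each lie in the
  domain of one chart; \<open>p\<close> is the coordinate expression of such an arc.
\<close>

inductive curve_length ::
    "('a, 'e::euclidean_space) chart set \<Rightarrow> ('a, 'e) metric_tensor \<Rightarrow> 'a \<Rightarrow> 'a \<Rightarrow> real \<Rightarrow> bool"
  for atlas g where
  arc: "\<lbrakk>c \<in> atlas; p C1_differentiable_on {0..1}; p ` {0..1} \<subseteq> coords c;
         x \<in> fst c; y \<in> fst c; snd c x = p 0; snd c y = p 1;
         l = integral {0..1} (\<lambda>t. sqrt (g c (p t) (vector_derivative p (at t))
                                                  (vector_derivative p (at t))))\<rbrakk>
        \<Longrightarrow> curve_length atlas g x y l"
| concatenation: "\<lbrakk>curve_length atlas g x y l; curve_length atlas g y z m\<rbrakk>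
        \<Longrightarrow> curve_length atlas g x z (l + m)"

text \<open>The distance between different connected components is \<open>\<infinity>\<close>.\<close>

definition riemannian_dist ::
    "('a, 'e::euclidean_space) chart set \<Rightarrow> ('a, 'e) metric_tensor \<Rightarrow> 'a \<Rightarrow> 'a \<Rightarrow> ereal" where
  "riemannian_dist atlas g x y = (INF l\<in>{l. curve_length atlas g x y l}. ereal l)"

definition riemannian_ball ::
    "('a, 'e::euclidean_space) chart set \<Rightarrow> ('a, 'e) metric_tensor \<Rightarrow> 'a \<Rightarrow> real \<Rightarrow> 'a set" where
  "riemannian_ball atlas g \<zeta> \<epsilon> = {x. riemannian_dist atlas g \<zeta> x < ereal \<epsilon>}"


section \<open>Decay of correlations\<close>

text \<open>
  A Banach space of genuine functions (not of classes modulo null sets): \<open>C\<close> is its underlying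
  set and \<open>N\<close> its norm.
\<close>

definition banach_function_space ::
    "'a measure \<Rightarrow> ('a \<Rightarrow> real) set \<Rightarrow> (('a \<Rightarrow> real) \<Rightarrow> real) \<Rightarrow> bool" where
  "banach_function_space M C N \<longleftrightarrow>
     C \<subseteq> borel_measurable M \<and>
     (\<lambda>_. 0) \<in> C \<and>
     (\<forall>\<phi>\<in>C. \<forall>\<psi>\<in>C. (\<lambda>x. \<phi> x + \<psi> x) \<in> C) \<and>
     (\<forall>a. \<forall>\<phi>\<in>C. (\<lambda>x. a * \<phi> x) \<in> C) \<and>
     (\<forall>\<phi>\<in>C. N \<phi> \<ge> 0) \<and>
     (\<forall>\<phi>\<in>C. N \<phi> = 0 \<longleftrightarrow> \<phi> = (\<lambda>_. 0)) \<and>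
     (\<forall>a. \<forall>\<phi>\<in>C. N (\<lambda>x. a * \<phi> x) = \<bar>a\<bar> * N \<phi>) \<and>
     (\<forall>\<phi>\<in>C. \<forall>\<psi>\<in>C. N (\<lambda>x. \<phi> x + \<psi> x) \<le> N \<phi> + N \<psi>) \<and>
     (\<forall>u. (\<forall>n. u n \<in> C) \<longrightarrow>
          (\<forall>e>0. \<exists>k::nat. \<forall>m\<ge>k. \<forall>n\<ge>k. N (\<lambda>x. u m x - u n x) < e) \<longrightarrow>
          (\<exists>\<phi>\<in>C. (\<lambda>n. N (\<lambda>x. u n x - \<phi> x)) \<longlonglongrightarrow> 0))"

text \<open>
  The two integrability conditions in the conclusion express that the integrals in the
  inequality exist; the value of \<open>\<gamma>\<close> at \<open>0\<close> is irrelevant.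
\<close>

definition decay_of_correlations_against_L1 ::
    "'a measure \<Rightarrow> ('a \<Rightarrow> 'a) \<Rightarrow> ('a \<Rightarrow> real) set \<Rightarrow> (('a \<Rightarrow> real) \<Rightarrow> real) \<Rightarrow> (nat \<Rightarrow> real) \<Rightarrow> bool"
  where
  "decay_of_correlations_against_L1 M f C N \<gamma> \<longleftrightarrow>
     banach_function_space M C N \<and>
     antimono_on {1..} \<gamma> \<and> \<gamma> \<longlonglongrightarrow> 0 \<and>
     (\<forall>\<phi>\<in>C. \<forall>\<psi>. \<forall>n\<ge>1.
        \<phi> \<noteq> (\<lambda>_. 0) \<and> integrable M \<psi> \<and> (\<integral>x. \<bar>\<psi> x\<bar> \<partial>M) \<noteq> 0 \<longrightarrow>
          integrable M \<phi> \<and> integrable M (\<lambda>x. \<phi> x * \<psi> ((f ^^ n) x)) \<and>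
          1 / (N \<phi> * (\<integral>x. \<bar>\<psi> x\<bar> \<partial>M)) *
            \<bar>(\<integral>x. \<phi> x * \<psi> ((f ^^ n) x) \<partial>M) - (\<integral>x. \<phi> x \<partial>M) * (\<integral>x. \<psi> x \<partial>M)\<bar> \<le> \<gamma> n)"


section \<open>Hitting times\<close>

text \<open>Here \<open>B\<close> is a ball; for \<open>j = 0\<close> the intersection is over the empty family, giving \<open>B\<close>.\<close>

definition annulus :: "('a \<Rightarrow> 'a) \<Rightarrow> 'a set \<Rightarrow> nat \<Rightarrow> 'a set" where
  "annulus f B j = B \<inter> (\<Inter>i\<in>{1..j}. (f ^^ i) -` (- B))"

text \<open>In \<^typ>\<open>enat\<close> the infimum of the empty set is \<open>\<infinity>\<close>.\<close>

definition hitting_time :: "('a \<Rightarrow> 'a) \<Rightarrow> 'a set \<Rightarrow> 'a \<Rightarrow> enat" where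
  "hitting_time f A x = Inf {enat j |j. j \<ge> 1 \<and> (f ^^ j) x \<in> A}"

definition first_return :: "('a \<Rightarrow> 'a) \<Rightarrow> 'a set \<Rightarrow> enat" where
  "first_return f A = (INF x\<in>A. hitting_time f A x)"

definition log_ereal :: "real \<Rightarrow> ereal" where
  "log_ereal p = (if p = 0 then - \<infinity> else ereal (ln p))"

definition prime_period :: "('a \<Rightarrow> 'a) \<Rightarrow> 'a \<Rightarrow> nat \<Rightarrow> bool" where
  "prime_period f \<zeta> p \<longleftrightarrow> p \<ge> 1 \<and> (f ^^ p) \<zeta> = \<zeta> \<and> (\<forall>j\<in>{1..<p}. (f ^^ j) \<zeta> \<noteq> \<zeta>)"

text \<open>\<open>B \<epsilon>\<close> is the ball of radius \<open>\<epsilon>\<close> around \<open>\<zeta>\<close>.\<close>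

definition regular_at :: "'a measure \<Rightarrow> ('a \<Rightarrow> 'a) \<Rightarrow> (real \<Rightarrow> 'a set) \<Rightarrow> 'a \<Rightarrow> bool" where
  "regular_at M f B \<zeta> \<longleftrightarrow>
     (\<forall>\<epsilon>>0. measure M (B \<epsilon>) > 0) \<and>
     (\<exists>\<epsilon>\<^sub>0>0. continuous_on {0<..<\<epsilon>\<^sub>0} (\<lambda>\<epsilon>. measure M (B \<epsilon>))) \<and>
     ((\<lambda>\<epsilon>. measure M (B \<epsilon>)) \<longlongrightarrow> 0) (at_right 0) \<and>
     (\<forall>p. prime_period f \<zeta> p \<longrightarrow>
        (\<forall>\<^sub>F \<epsilon> in at_right 0.
           B \<epsilon> \<inter> (f ^^ p) -` B \<epsilon> \<noteq> {} \<and>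
           (\<forall>j\<in>{1..<p}. B \<epsilon> \<inter> (f ^^ j) -` B \<epsilon> = {}) \<and>
           (\<Inter>k. (f ^^ (k * p)) -` B \<epsilon>) = {\<zeta>}) \<and>
        (\<exists>\<theta>. 0 < \<theta> \<and> \<theta> < 1 \<and>
           (\<lambda>\<epsilon>. measure M (B \<epsilon> \<inter> (f ^^ p) -` B \<epsilon>))
             \<sim>[at_right 0] (\<lambda>\<epsilon>. (1 - \<theta>) * measure M (B \<epsilon>))))"

end

(* Let v t be the probability that an orbit avoids the ball U during the times 0, ..., t - 1. By
   invariance, v t - v (t + 1) is the probability of starting in U and then avoiding it for t steps;
   for t >= q such a point already lies in the annulus A. Waiting n steps before looking at the rest
   of the orbit, decay of correlations bounds this difference above by (P(A) + K gamma(n)) v (t + 1 - n).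
   It is also at least about P(A) v t: the loss from waiting comes from the returns to A at times
   j < n, and these are controlled by n P(U) plus the tail of the sum of gamma beyond the first return
   time of A. The choice n ~ e / P(U) makes all errors small relative to P(U), so v decays exponentially
   at rate (theta + o(1)) P(U); the limit exists and equals -theta. *)

theory Submission
  imports Defs "HOL-Real_Asymp.Real_Asymp"
begin

section \<open>Choice of the waiting time and scalar recursions\<close>

lemma nonneg_of_antimono_tendsto_0:
  fixes \<gamma> :: "nat \<Rightarrow> real"
  assumes "antimono_on {1..} \<gamma>" "\<gamma> \<longlonglongrightarrow> 0" "n \<ge> 1"
  shows "\<gamma> n \<ge> 0"
proof (rule tendsto_upperbound[OF assms(2)])
  show "\<forall>\<^sub>F k in sequentially. \<gamma> k \<le> \<gamma> n"
    using eventually_ge_at_top[of n] by eventually_elim (use monotone_onD[OF assms(1), of n] assms(3) in auto)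
qed simp

text \<open>The witness is the integer part of \<open>e / b x\<close>. It tends to infinity, so
  \<open>n * \<gamma> n\<close> falls below \<open>e\<^sup>2 / 2\<close>, while
  \<open>n * b x\<close> stays at least \<open>e / 2\<close>; the quotient of the two bounds
  controls \<open>\<gamma> n\<close>.\<close>

lemma eventually_gap:
  fixes \<gamma> :: "nat \<Rightarrow> real" and b :: "'b \<Rightarrow> real"
  assumes lim: "(\<lambda>n. real n * \<gamma> n) \<longlonglongrightarrow> 0"
    and b: "(b \<longlongrightarrow> 0) F" "\<forall>\<^sub>F x in F. b x > 0" and e: "e > 0"
  shows "\<forall>\<^sub>F x in F. \<exists>n\<ge>k. real n * b x \<le> e \<and> \<gamma> n \<le> e * b x"
proof -
  have "\<forall>\<^sub>F n in sequentially. real n * \<gamma> n < e\<^sup>2 / 2"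
    using order_tendstoD(2)[OF lim, of "e\<^sup>2 / 2"] e by simp
  then obtain n\<^sub>0 where n\<^sub>0: "\<And>n. n \<ge> n\<^sub>0 \<Longrightarrow> real n * \<gamma> n < e\<^sup>2 / 2"
    by (auto simp: eventually_sequentially)
  \<comment> \<open>The entry 1 ensures \<open>n + 1 \<le> 2 * n\<close> below, so rounding down
    costs at most a factor 2.\<close>
  define m where "m = Max {k, n\<^sub>0, 1}"
  have m: "m \<ge> k" "m \<ge> n\<^sub>0" "m \<ge> 1" by (auto simp: m_def)
  have "\<forall>\<^sub>F x in F. b x < e / (m + 1)"
    using order_tendstoD(2)[OF b(1), of "e / (m + 1)"] e by simp
  then show ?thesis using b(2)
  proof eventually_elim
    case (elim x)
    define n where "n = nat \<lfloor>e / b x\<rfloor>"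
    have q: "e / b x > m + 1" using elim by (simp add: field_simps)
    have n: "real n \<le> e / b x" "e / b x < real n + 1"
      using q unfolding n_def by linarith+
    have "n \<ge> m" using n q by linarith
    have nb: "real n * b x \<le> e" using n(1) elim by (simp add: field_simps)
    have "e / b x \<le> 2 * real n" using n(2) \<open>n \<ge> m\<close> m by linarith
    then have e2: "e \<le> 2 * real n * b x" using elim by (simp add: field_simps)
    have "real n * \<gamma> n \<le> e\<^sup>2 / 2" using n\<^sub>0[of n] \<open>n \<ge> m\<close> m by simp
    also have "\<dots> \<le> e * (2 * real n * b x) / 2"
      using mult_left_mono[OF e2, of e] e by (simp add: power2_eq_square)
    finally have "real n * \<gamma> n \<le> real n * (e * b x)" by (simp add: mult_ac)
    then have "\<gamma> n \<le> e * b x" using \<open>n \<ge> m\<close> m by simp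
    then show ?case using nb \<open>n \<ge> m\<close> m by (intro exI[of _ n]) auto
  qed
qed

lemma ratio_bound_iterate:
  fixes v :: "nat \<Rightarrow> real"
  assumes "\<And>t. t \<ge> s \<Longrightarrow> t < s + k \<Longrightarrow> v t \<le> c * v (Suc t)" "c \<ge> 0"
  shows "v s \<le> c ^ k * v (s + k)"
  using assms(1)
proof (induction k)
  case (Suc k)
  have "v s \<le> c ^ k * v (s + k)" using Suc by simp
  also have "\<dots> \<le> c ^ k * (c * v (Suc (s + k)))"
    using Suc.prems[of "s + k"] assms(2) by (intro mult_left_mono) auto
  finally show ?case by (simp add: mult_ac)
qed simp

text \<open>A crude a priori bound by strong induction: the ratios already established carry the
  delayed value \<open>v (Suc t - n)\<close> forward to \<open>v t\<close> at a cost below 2,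
  because \<open>n * b\<close> is small. Positivity is passed on by the preceding ratio.\<close>

lemma delayed_recursion_ratio:
  fixes v :: "nat \<Rightarrow> real"
  assumes v0: "v 0 = 1" and b: "0 < b" and n: "n \<ge> 1" and nb: "real n * b \<le> 1/8"
    and step: "\<And>t. v t - v (Suc t) \<le> b"
    and rec: "\<And>t. t \<ge> n \<Longrightarrow> v t - v (Suc t) \<le> c * v (Suc t - n)"
    and c: "0 \<le> c" "c \<le> 2 * b"
  shows "v t > 0 \<and> v t \<le> (1 + 4 * b) * v (Suc t)"
proof (induction t rule: less_induct)
  case (less t)
  have pos: "v t > 0"
  proof (cases t)
    case (Suc t')
    then have "v t' > 0" "v t' \<le> (1 + 4 * b) * v t" using less[of t'] by auto
    then have "(1 + 4 * b) * v t > 0" by linarith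
    then show ?thesis using b by (simp add: zero_less_mult_iff)
  qed (simp add: v0)
  have e2: "(1 + 4 * b) ^ n \<le> 2"
  proof -
    have "(1 + 4 * b) ^ n \<le> exp (4 * b) ^ n" using b by (intro power_mono) (auto simp: exp_ge_add_one_self)
    also have "\<dots> = exp (4 * (real n * b))" by (simp add: exp_of_nat_mult[symmetric] mult_ac)
    also have "\<dots> \<le> exp (1/2)" using nb by simp
    also have "\<dots> \<le> 2" using exp_half_le2 by simp
    finally show ?thesis .
  qed
  show ?case
  proof (cases "t \<ge> n")
    case True
    have "v (Suc t - n) \<le> (1 + 4 * b) ^ (n - 1) * v (Suc t - n + (n - 1))"
      using less b n True by (intro ratio_bound_iterate) auto
    also have "Suc t - n + (n - 1) = t" using n True by simp
    finally have w: "v (Suc t - n) \<le> (1 + 4 * b) ^ (n - 1) * v t" .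
    have "v t - v (Suc t) \<le> c * v (Suc t - n)" by (rule rec[OF True])
    also have "\<dots> \<le> (2 * b) * ((1 + 4 * b) ^ (n - 1) * v t)"
      using c w b pos by (intro order.trans[OF mult_left_mono[OF w] mult_right_mono]) auto
    finally have d: "v t - v (Suc t) \<le> (2 * b * (1 + 4 * b) ^ (n - 1)) * v t" by (simp add: mult_ac)
    \<comment> \<open>The delay uses up \<open>n - 1\<close> factors; the remaining one turns a
      bound in terms of \<open>v t\<close> into one in terms of \<open>v (Suc t)\<close>.\<close>
    have "(1 + 4 * b) ^ (n - 1) * (1 + 4 * b) \<le> 2"
      using e2 n by (simp add: power_eq_if mult_ac)
    then have "(2 * b * (1 + 4 * b) ^ (n - 1)) * (1 + 4 * b) \<le> 4 * b"
      using mult_left_mono[of "(1 + 4 * b) ^ (n - 1) * (1 + 4 * b)" 2 "2 * b"] b by (simp add: mult_ac)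
    then have "((2 * b * (1 + 4 * b) ^ (n - 1)) * (1 + 4 * b)) * v t \<le> 4 * b * v t"
      using pos by (intro mult_right_mono) auto
    moreover have "(1 + 4 * b) * (v t - v (Suc t))
        \<le> (1 + 4 * b) * ((2 * b * (1 + 4 * b) ^ (n - 1)) * v t)"
      using b by (intro mult_left_mono[OF d]) simp
    ultimately have "(1 + 4 * b) * (v t - v (Suc t)) \<le> 4 * b * v t"
      by (simp only: mult.assoc mult.left_commute mult.commute)
    then have "v t \<le> (1 + 4 * b) * v (Suc t)" by (simp add: algebra_simps)
    with pos show ?thesis by simp
  next
    case False
    \<comment> \<open>For \<open>t < n\<close> the recursion says nothing, but the total loss is at
      most \<open>n * b \<le> 1/8\<close>, so \<open>v\<close> stays above 7/8 and \<open>b\<close>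
      is below \<open>4 * b * v (Suc t)\<close>.\<close>
    have "v 0 - v k \<le> real k * b" for k
    proof (induction k)
      case (Suc k)
      then show ?case using step[of k] by (simp add: algebra_simps)
    qed simp
    from this[of "Suc t"] have "1 - v (Suc t) \<le> real (Suc t) * b" by (simp add: v0)
    also have "\<dots> \<le> real n * b" using False b by (intro mult_right_mono) auto
    finally have "v (Suc t) \<ge> 7/8" using nb by simp
    then have "b \<le> 4 * b * v (Suc t)" using b by simp
    then show ?thesis using step[of t] pos by (simp add: algebra_simps)
  qed
qed

section \<open>Survivor sets of a system with a hole\<close>

text \<open>The hole \<open>U\<close> stands for one fixed ball, with the geometry forgotten: the
  estimates are proved for a single hole with explicit constants, and the radius varies only at the
  very end.\<close>

locale open_system = prob_space M for M :: "'a measure" +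
  fixes f :: "'a \<Rightarrow> 'a" and U :: "'a set" and q :: nat
  assumes f_meas: "f \<in> M \<rightarrow>\<^sub>M M" and f_inv: "distr M M f = M" and space_UNIV: "space M = UNIV"
    and U_sets: "U \<in> sets M"
begin

definition survivors :: "nat \<Rightarrow> 'a set" where
  "survivors t = {x. \<forall>i<t. (f ^^ i) x \<notin> U}"

abbreviation core :: "'a set" where "core \<equiv> annulus f U q"

lemma funpow_meas: "(f ^^ n) \<in> M \<rightarrow>\<^sub>M M"
  using f_meas by (induction n) (auto simp: id_def[symmetric])

lemma vimage_sets: "E \<in> sets M \<Longrightarrow> (f ^^ n) -` E \<in> sets M"
  using measurable_sets[OF funpow_meas] by (simp add: space_UNIV)

lemma vimage1_sets: "E \<in> sets M \<Longrightarrow> f -` E \<in> sets M"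
  using vimage_sets[of E 1] by simp

lemma prob_vimage1: "E \<in> sets M \<Longrightarrow> prob (f -` E) = prob E"
  using measure_distr[OF f_meas, of E] by (simp add: f_inv space_UNIV)

lemma prob_vimage: "E \<in> sets M \<Longrightarrow> prob ((f ^^ n) -` E) = prob E"
proof (induction n arbitrary: E)
  case (Suc n)
  have "(f ^^ Suc n) -` E = (f ^^ n) -` (f -` E)" by auto
  then show ?case using Suc vimage1_sets prob_vimage1 by (simp del: funpow.simps)
qed simp

lemma avoid_sets: "{x. (f ^^ i) x \<notin> U} \<in> sets M"
proof -
  have "{x. (f ^^ i) x \<notin> U} = space M - (f ^^ i) -` U" by (auto simp: space_UNIV)
  then show ?thesis using vimage_sets[OF U_sets, of i] by (simp add: sets.compl_sets)
qed

lemma survivors_sets: "survivors t \<in> sets M"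
proof -
  have "survivors t = {x \<in> space M. \<forall>i\<in>{..<t}. (f ^^ i) x \<notin> U}"
    by (auto simp: survivors_def space_UNIV)
  also have "\<dots> \<in> sets M"
    using avoid_sets by (intro sets.sets_Collect_finite_All) (auto simp: space_UNIV)
  finally show ?thesis .
qed

lemma core_sets: "core \<in> sets M"
proof -
  have "core = U \<inter> {x \<in> space M. \<forall>i\<in>{1..q}. (f ^^ i) x \<notin> U}"
    by (auto simp: annulus_def space_UNIV)
  moreover have "{x \<in> space M. \<forall>i\<in>{1..q}. (f ^^ i) x \<notin> U} \<in> sets M"
    using avoid_sets by (intro sets.sets_Collect_finite_All) (auto simp: space_UNIV)
  ultimately show ?thesis using U_sets by auto
qed

lemmas ev_sets = vimage_sets vimage1_sets survivors_sets core_sets U_sets sets.Int sets.Un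

lemma survivors_mono: "s \<le> t \<Longrightarrow> survivors t \<subseteq> survivors s"
  by (auto simp: survivors_def)

lemma survivors_Suc: "survivors (Suc t) = - U \<inter> f -` survivors t"
  by (auto simp: survivors_def funpow_Suc_right less_Suc_eq_0_disj simp del: funpow.simps)

lemma core_subset: "core \<subseteq> U" by (auto simp: annulus_def)

text \<open>The annulus asks for avoidance at the times 1 to \<open>q\<close> only, all of them
  among the times 1 to \<open>t\<close>. This replaces \<open>U\<close> by the set whose indicator
  is assumed to lie in the Banach space.\<close>

lemma core_survivors: "t \<ge> q \<Longrightarrow> U \<inter> f -` survivors t = core \<inter> f -` survivors t"
proof -
  assume "t \<ge> q"
  have "x \<in> core" if "x \<in> U" "f x \<in> survivors t" for x
  proof -
    have "(f ^^ i) x \<notin> U" if "i \<in> {1..q}" for i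
    proof -
      from that obtain k where "i = Suc k" "k < t" using \<open>t \<ge> q\<close> by (cases i) auto
      then show ?thesis using \<open>f x \<in> survivors t\<close>
        by (simp add: survivors_def funpow_Suc_right del: funpow.simps)
    qed
    then show ?thesis using \<open>x \<in> U\<close> by (auto simp: annulus_def)
  qed
  then show ?thesis using core_subset by auto
qed

abbreviation v :: "nat \<Rightarrow> real" where "v t \<equiv> prob (survivors t)"
abbreviation a :: "nat \<Rightarrow> real" where "a t \<equiv> prob (core \<inter> f -` survivors t)"

lemma v_diff_U: "v t - v (Suc t) = prob (U \<inter> f -` survivors t)"
proof -
  have "f -` survivors t = (U \<inter> f -` survivors t) \<union> survivors (Suc t)"
    by (auto simp: survivors_Suc)
  then have "prob (f -` survivors t) = prob (U \<inter> f -` survivors t) + v (Suc t)"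
    by (metis (no_types, lifting) ev_sets survivors_Suc Compl_disjoint Int_assoc Int_left_commute
        finite_measure_Union inf_bot_right inf_commute)
  then show ?thesis by (simp add: prob_vimage1 ev_sets)
qed

lemma v_diff: "t \<ge> q \<Longrightarrow> v t - v (Suc t) = a t"
  by (simp add: v_diff_U core_survivors)

text \<open>Accounts for the loss from waiting: the orbits that avoid \<open>U\<close> from time
  \<open>n\<close> on but visited it earlier. Decomposing by the last visit makes the error events
  again of the form counted by \<open>a s\<close>.\<close>

lemma core_split:
  assumes s: "s \<ge> q" and n: "n \<ge> 1" and R: "enat R \<le> first_return f core"
  shows "core \<inter> (f ^^ n) -` survivors s \<subseteq>
    (core \<inter> f -` survivors (s + n - 1)) \<union>
    (\<Union>j\<in>{R..<n}. core \<inter> (f ^^ j) -` (core \<inter> f -` survivors s))"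
proof
  fix x assume x: "x \<in> core \<inter> (f ^^ n) -` survivors s"
  have late: "(f ^^ i) x \<notin> U" if "i \<ge> n" "i < n + s" for i
  proof -
    have "(f ^^ i) x = (f ^^ (i - n)) ((f ^^ n) x)"
      using that by (simp add: funpow_add[symmetric, THEN fun_cong, unfolded comp_def])
    then show ?thesis using x that by (simp add: survivors_def)
  qed
  \<comment> \<open>\<open>Max J\<close> is the last visit to \<open>U\<close> before time \<open>n\<close>; from there on the orbit survives, so by
    \<open>core_survivors\<close> this visit is in the core.\<close>
  define J where "J = {j\<in>{1..<n}. (f ^^ j) x \<in> U}"
  show "x \<in> (core \<inter> f -` survivors (s + n - 1)) \<union>
    (\<Union>j\<in>{R..<n}. core \<inter> (f ^^ j) -` (core \<inter> f -` survivors s))"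
  proof (cases "J = {}")
    case True
    have "(f ^^ i) (f x) \<notin> U" if "i < s + n - 1" for i
      using True late[of "Suc i"] that
      by (cases "Suc i < n") (auto simp: J_def funpow_Suc_right simp del: funpow.simps)
    then show ?thesis using x by (auto simp: survivors_def)
  next
    case False
    define j where "j = Max J"
    have fin: "finite J" by (simp add: J_def)
    have j: "j \<ge> 1" "j < n" "(f ^^ j) x \<in> U" using Max_in[OF fin False] by (auto simp: J_def j_def)
    have no: "(f ^^ i) x \<notin> U" if "i > j" "i < n + s" for i
    proof (cases "i < n")
      case True
      then show ?thesis using that Max_ge[OF fin, of i] j unfolding j_def[symmetric]
        by (auto simp: J_def)
    qed (use late that in auto)
    \<comment> \<open>Only the times \<open>j + 1\<close> to \<open>j + s\<close> matter; they lie
      below \<open>n + s\<close> because \<open>j < n\<close>.\<close>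
    have sv: "f ((f ^^ j) x) \<in> survivors s"
    proof -
      have "(f ^^ i) (f ((f ^^ j) x)) = (f ^^ (i + Suc j)) x" for i
        by (simp only: funpow_add comp_apply funpow.simps(2))
      then show ?thesis using no j by (auto simp: survivors_def simp del: funpow.simps)
    qed
    then have "(f ^^ j) x \<in> core" using core_survivors[OF s] j by blast
    moreover have "R \<le> j"
    proof -
      have "first_return f core \<le> hitting_time f core x"
        using x by (auto simp: first_return_def intro: INF_lower)
      also have "\<dots> \<le> enat j"
        unfolding hitting_time_def using j \<open>(f ^^ j) x \<in> core\<close> by (intro Inf_lower) auto
      finally show ?thesis using R by (metis enat_ord_simps(1) order.trans)
    qed
    ultimately show ?thesis using j x sv by auto
  qed
qed

end

section \<open>Decay of correlations for events\<close>

text \<open>The second observable is the indicator of \<open>E\<close>, whose L1 norm is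
  \<open>prob E\<close>. The error is thus proportional to \<open>prob E\<close>, which keeps all
  later errors relative to the survival probability.\<close>

lemma (in open_system) decay_on_events:
  assumes dec: "decay_of_correlations_against_L1 M f C N \<gamma>"
    and C: "indicator core \<in> C" "N (indicator core) \<le> K"
    and E: "E \<in> sets M" and n: "n \<ge> 1"
  shows "\<bar>prob (core \<inter> (f ^^ n) -` E) - prob core * prob E\<bar> \<le> K * \<gamma> n * prob E"
proof -
  have \<gamma>: "\<gamma> n \<ge> 0"
    using dec n unfolding decay_of_correlations_against_L1_def
    by (auto intro: nonneg_of_antimono_tendsto_0)
  have ban: "banach_function_space M C N"
    using dec by (auto simp: decay_of_correlations_against_L1_def)
  have Npos: "N (indicator core) \<ge> 0" using ban C by (auto simp: banach_function_space_def)
  then have K: "K \<ge> 0" using C by simp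
  show ?thesis
  \<comment> \<open>The decay inequality speaks of nonzero observables only; in the degenerate cases
    the left side vanishes. A nonempty null \<open>core\<close> belongs to the main case, since
    \<open>C\<close> consists of functions rather than classes.\<close>
  proof (cases "core = {} \<or> prob E = 0")
    case True
    have "prob (core \<inter> (f ^^ n) -` E) \<le> prob E"
      using prob_vimage[OF E, of n] E
      by (metis finite_measure_mono inf_le2 vimage_sets)
    then have "prob (core \<inter> (f ^^ n) -` E) = 0" if "prob E = 0"
      using that by (simp add: measure_le_0_iff)
    with True show ?thesis using \<gamma> K by auto
  next
    case False
    then have nz: "(indicator core :: 'a \<Rightarrow> real) \<noteq> (\<lambda>_. 0)"
      by (auto simp: fun_eq_iff indicator_def)
    then have NP: "N (indicator core) > 0"
      using ban C Npos unfolding banach_function_space_def by force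
    have PE: "prob E > 0" using False by (simp add: zero_less_measure_iff)
    have i1: "(\<integral>x. \<bar>indicator E x :: real\<bar> \<partial>M) = prob E"
      using E by simp
    have i2: "(\<integral>x. indicator core x * indicator E ((f ^^ n) x) \<partial>M) = prob (core \<inter> (f ^^ n) -` E)"
    proof -
      have "(\<lambda>x. indicator core x * indicator E ((f ^^ n) x) :: real)
          = indicator (core \<inter> (f ^^ n) -` E)"
        by (auto simp: fun_eq_iff indicator_def)
      then show ?thesis using E by (simp add: ev_sets)
    qed
    have "integrable M (indicator E :: 'a \<Rightarrow> real)" using E by (simp add: emeasure_eq_measure)
    then have "1 / (N (indicator core) * prob E) *
        \<bar>prob (core \<inter> (f ^^ n) -` E) - prob core * prob E\<bar> \<le> \<gamma> n"
      using dec C nz n PE i1 i2 core_sets E unfolding decay_of_correlations_against_L1_def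
      by (elim conjE ballE[of _ _ "indicator core"] allE[of _ "indicator E"] allE[of _ n]) auto
    then have "\<bar>prob (core \<inter> (f ^^ n) -` E) - prob core * prob E\<bar> \<le> N (indicator core) * \<gamma> n * prob E"
      using NP PE by (simp add: field_simps)
    also have "\<dots> \<le> K * \<gamma> n * prob E"
      using C \<gamma> by (intro mult_right_mono) auto
    finally show ?thesis .
  qed
qed

section \<open>Logarithmic rates and hitting times\<close>

text \<open>Summing the logarithms of the ratios from \<open>m\<close> on traps
  \<open>ln (v t)\<close> between affine functions of slopes \<open>- \<eta>\<close> and
  \<open>- \<kappa>\<close>; division by \<open>t\<close> removes the intercepts and the effect of
  rounding.\<close>

lemma Limsup_log_rate:
  fixes v :: "nat \<Rightarrow> real"
  assumes pos: "\<And>t. v t > 0"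
    and lower: "\<And>t. t \<ge> m \<Longrightarrow> v t \<le> exp \<eta> * v (Suc t)"
    and upper: "\<And>t. t \<ge> m \<Longrightarrow> v (Suc t) \<le> exp (- \<kappa>) * v t"
  defines "G \<equiv> Limsup at_top (\<lambda>t::real. ereal (1 / t) * log_ereal (v (nat \<lfloor>t\<rfloor>)))"
  shows "ereal (- \<eta>) \<le> G" "G \<le> ereal (- \<kappa>)"
proof -
  \<comment> \<open>The affine function with value \<open>c\<close> at \<open>m\<close> and slope
    \<open>- k\<close>, taken at the integer part of \<open>t\<close> and divided by
    \<open>t\<close>.\<close>
  define h where "h = (\<lambda>c k t. (c - k * (real (nat \<lfloor>t\<rfloor>) - real m)) / t :: real)"
  have lim: "((\<lambda>t. ereal (h c k t)) \<longlongrightarrow> ereal (- k)) at_top" for c k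
  proof (intro tendsto_ereal)
    have fl: "((\<lambda>t::real. real (nat \<lfloor>t\<rfloor>) / t) \<longlongrightarrow> 1) at_top"
    proof (rule tendsto_sandwich)
      show "\<forall>\<^sub>F t::real in at_top. (t - 1) / t \<le> real (nat \<lfloor>t\<rfloor>) / t"
        using eventually_gt_at_top[of 0] by eventually_elim (intro divide_right_mono; linarith)
      show "\<forall>\<^sub>F t::real in at_top. real (nat \<lfloor>t\<rfloor>) / t \<le> 1"
        using eventually_gt_at_top[of 0] by eventually_elim (simp add: field_simps)
      show "((\<lambda>t::real. (t - 1) / t) \<longlongrightarrow> 1) at_top" by real_asymp
    qed simp
    have "((\<lambda>t::real. (c + k * real m) / t - k * (real (nat \<lfloor>t\<rfloor>) / t)) \<longlongrightarrow> 0 - k * 1) at_top"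
      by (intro tendsto_intros fl tendsto_divide_0[OF tendsto_const] filterlim_at_top_imp_at_infinity filterlim_ident)
    then show "(h c k \<longlongrightarrow> - k) at_top"
      by (simp add: h_def algebra_simps diff_divide_distrib add_divide_distrib)
  qed
  have G: "G = Limsup at_top (\<lambda>t::real. ereal (ln (v (nat \<lfloor>t\<rfloor>)) / t))"
    using pos unfolding G_def log_ereal_def by (simp add: less_imp_neq[THEN not_sym])
  have low: "ln (v t) \<ge> ln (v m) - \<eta> * (real t - real m)" if "t \<ge> m" for t
    using that
  proof (induction rule: dec_induct)
    case (step t)
    have "ln (v t) \<le> ln (exp \<eta> * v (Suc t))" using lower[of t] pos step by (subst ln_le_cancel_iff) auto
    then show ?case using step pos[of "Suc t"] by (simp add: ln_mult algebra_simps)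
  qed simp
  have up: "ln (v t) \<le> ln (v m) - \<kappa> * (real t - real m)" if "t \<ge> m" for t
    using that
  proof (induction rule: dec_induct)
    case (step t)
    have "ln (v (Suc t)) \<le> ln (exp (- \<kappa>) * v t)" using upper[of t] pos step by (subst ln_le_cancel_iff) auto
    then show ?case using step pos[of t] by (simp add: ln_mult algebra_simps)
  qed simp
  have ev: "\<forall>\<^sub>F t::real in at_top. t > 0 \<and> nat \<lfloor>t\<rfloor> \<ge> m"
    using eventually_ge_at_top[of "real m + 1"] by eventually_elim linarith
  have "ereal (- \<eta>) = Limsup at_top (\<lambda>t. ereal (h (ln (v m)) \<eta> t))"
    by (rule lim_imp_Limsup[symmetric, OF _ lim]) simp
  also have "\<dots> \<le> G" unfolding G
    by (rule Limsup_mono) (use ev low in \<open>auto simp: h_def intro!: divide_right_mono elim!: eventually_mono\<close>)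
  finally show "ereal (- \<eta>) \<le> G" .
  have "G \<le> Limsup at_top (\<lambda>t. ereal (h (ln (v m)) \<kappa> t))" unfolding G
    by (rule Limsup_mono) (use ev up in \<open>auto simp: h_def intro!: divide_right_mono elim!: eventually_mono\<close>)
  also have "\<dots> = ereal (- \<kappa>)"
    by (rule lim_imp_Limsup[OF _ lim]) simp
  finally show "G \<le> ereal (- \<kappa>)" .
qed

text \<open>Hitting times start at 1 and survival at 0, so the event is a preimage under
  \<open>f\<close> of a survivor set, and invariance removes the shift. Integer values turn
  \<open>> t\<close> into \<open>\<ge> \<lfloor>t\<rfloor> + 1\<close>.\<close>

lemma (in open_system) hitting_time_gt:
  assumes "t \<ge> 0"
  shows "prob {x \<in> space M. ereal_of_enat (hitting_time f U x) > ereal t} = v (nat \<lfloor>t\<rfloor>)"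
proof -
  have *: "ereal_of_enat h > ereal t \<longleftrightarrow> h \<ge> enat (Suc (nat \<lfloor>t\<rfloor>))" for h
    using assms by (cases h) (auto, linarith+)
  have "ereal_of_enat (hitting_time f U x) > ereal t \<longleftrightarrow> f x \<in> survivors (nat \<lfloor>t\<rfloor>)" for x
  proof -
    have "ereal_of_enat (hitting_time f U x) > ereal t \<longleftrightarrow>
        (\<forall>j\<ge>1. (f ^^ j) x \<in> U \<longrightarrow> Suc (nat \<lfloor>t\<rfloor>) \<le> j)"
      unfolding * hitting_time_def le_Inf_iff by auto
    also have "\<dots> \<longleftrightarrow> (\<forall>i. (f ^^ Suc i) x \<in> U \<longrightarrow> nat \<lfloor>t\<rfloor> \<le> i)"
      by (metis One_nat_def Suc_le_D Suc_le_mono le_numeral_extra(4) not_less_eq_eq zero_le)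
    also have "\<dots> \<longleftrightarrow> f x \<in> survivors (nat \<lfloor>t\<rfloor>)"
      by (auto simp: survivors_def funpow_Suc_right not_less simp del: funpow.simps)
    finally show ?thesis .
  qed
  then have "{x \<in> space M. ereal_of_enat (hitting_time f U x) > ereal t} = f -` survivors (nat \<lfloor>t\<rfloor>)"
    by (auto simp: space_UNIV)
  then show ?thesis by (simp add: prob_vimage1 survivors_sets)
qed


section \<open>Two-sided bounds on the survival ratio\<close>

text \<open>A bootstrap: the crude ratio \<open>1 + 4 * b\<close> is fed back into the correlation
  estimates at lag \<open>n\<close>. Both resulting exponents differ from \<open>prob core\<close>
  by \<open>prob U\<close> times a quantity vanishing with \<open>e\<close>.\<close>

lemma (in open_system) survivors_rates:
  assumes dec: "decay_of_correlations_against_L1 M f C N \<gamma>"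
    and C: "indicator core \<in> C" "N (indicator core) \<le> K" and K: "K > 0"
    and U: "prob U > 0"
    and R: "enat R \<le> first_return f core" "R \<ge> 1" and tail: "(\<Sum>j\<in>{R..<n}. \<gamma> j) \<le> e"
    and n: "n \<ge> q" "n \<ge> 1" and nb: "real n * prob U \<le> e" and \<gamma>n: "\<gamma> n \<le> e * prob U"
    and e: "e \<le> 1/8" "K * e \<le> 1"
  shows "v t > 0"
    and "t \<ge> n \<Longrightarrow> v t \<le> exp ((prob core + K * e * prob U) * exp (4 * e)) * v (Suc t)"
    and "t \<ge> 2 * n \<Longrightarrow> v (Suc t) \<le> exp (- (prob core - (K * e + 4 * (e + K * e)) * prob U)) * v t"
proof -
  define b where "b = prob U"
  define c where "c = prob core + K * \<gamma> n"
  have b: "b > 0" using U by (simp add: b_def)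
  have "antimono_on {1..} \<gamma>" "\<gamma> \<longlonglongrightarrow> 0"
    using dec by (auto simp: decay_of_correlations_against_L1_def)
  then have \<gamma>: "\<gamma> j \<ge> 0" if "j \<ge> 1" for j
    using that by (rule nonneg_of_antimono_tendsto_0)
  have core_le: "prob core \<le> b"
    unfolding b_def by (rule finite_measure_mono[OF core_subset U_sets])
  have K\<gamma>: "K * \<gamma> n \<le> K * e * b"
    using \<gamma>n K by (simp add: b_def mult.assoc)
  have "K * e * b \<le> 1 * b" using e b by (intro mult_right_mono) auto
  with K\<gamma> have "K * \<gamma> n \<le> b" by linarith
  moreover have "0 \<le> K * \<gamma> n" using K \<gamma>[OF n(2)] by simp
  moreover have "0 \<le> prob core" by simp
  \<comment> \<open>The bound \<open>2 * b\<close> serves the crude estimate, the last one the sharp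
    rate.\<close>
  ultimately have c: "0 \<le> c" "c \<le> 2 * b" "c \<le> prob core + K * e * b"
    using K\<gamma> core_le unfolding c_def by linarith+
  have step: "v t - v (Suc t) \<le> b" for t
    unfolding v_diff_U b_def by (rule finite_measure_mono) (auto simp: ev_sets)
  have corr: "\<bar>prob (core \<inter> (f ^^ j) -` E) - prob core * prob E\<bar> \<le> K * \<gamma> j * prob E"
    if "E \<in> sets M" "j \<ge> 1" for E j
    using decay_on_events[OF dec C that] .
  have rec: "v t - v (Suc t) \<le> c * v (Suc t - n)" if "t \<ge> n" for t
  proof -
    \<comment> \<open>Avoidance at the times 1 to \<open>n - 1\<close> is dropped; the
      \<open>Suc t - n\<close> times from \<open>n\<close> to \<open>t\<close> remain.\<close>
    have "f -` survivors t \<subseteq> (f ^^ n) -` survivors (Suc t - n)"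
    proof
      fix x assume x: "x \<in> f -` survivors t"
      have "(f ^^ i) ((f ^^ n) x) \<notin> U" if "i < Suc t - n" for i
      proof -
        obtain k where k: "n = Suc k" using n(2) by (cases n) auto
        have "(f ^^ i) ((f ^^ n) x) = (f ^^ (i + k)) (f x)"
          by (simp add: k funpow_Suc_right funpow_add del: funpow.simps(2))
        moreover have "i + k < t" using that k by simp
        ultimately show ?thesis using x by (simp add: survivors_def)
      qed
      then show "x \<in> (f ^^ n) -` survivors (Suc t - n)" by (simp add: survivors_def)
    qed
    then have "a t \<le> prob (core \<inter> (f ^^ n) -` survivors (Suc t - n))"
      by (intro finite_measure_mono) (auto simp: ev_sets)
    also have "\<dots> \<le> c * v (Suc t - n)"
      using corr[OF survivors_sets n(2), of "Suc t - n"] by (simp add: c_def algebra_simps)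
    finally show ?thesis using v_diff that n(1) by simp
  qed
  have "v 0 = 1" using prob_space by (simp add: survivors_def space_UNIV)
  then have crude: "v t > 0 \<and> v t \<le> (1 + 4 * b) * v (Suc t)" for t
    using nb e by (intro delayed_recursion_ratio[OF _ b n(2) _ step rec c(1,2)]) (auto simp: b_def)
  show "v t > 0" using crude by simp
  show "v t \<le> exp ((prob core + K * e * prob U) * exp (4 * e)) * v (Suc t)" if t: "t \<ge> n"
  proof -
    \<comment> \<open>Going \<open>n\<close> steps forward with the crude ratio costs only
      \<open>exp (4 * e)\<close>, since \<open>n * b \<le> e\<close>.\<close>
    have "v (Suc t - n) \<le> (1 + 4 * b) ^ n * v (Suc t - n + n)"
      using crude b by (intro ratio_bound_iterate) auto
    also have "Suc t - n + n = Suc t" using t by simp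
    also have "(1 + 4 * b) ^ n \<le> exp (4 * b) ^ n"
      using b by (intro power_mono) (auto simp: exp_ge_add_one_self)
    also have "\<dots> = exp (4 * (real n * b))" by (simp add: exp_of_nat_mult[symmetric] mult_ac)
    also have "\<dots> \<le> exp (4 * e)" using nb by (simp add: b_def)
    finally have w: "v (Suc t - n) \<le> exp (4 * e) * v (Suc t)" by (simp add: mult_right_mono)
    let ?\<eta> = "(prob core + K * e * b) * exp (4 * e)"
    have "v t - v (Suc t) \<le> c * (exp (4 * e) * v (Suc t))"
      using rec[OF t] mult_left_mono[OF w c(1)] by simp
    also have "\<dots> \<le> ?\<eta> * v (Suc t)"
      using c(3) by (simp add: mult_right_mono mult.assoc[symmetric])
    finally have "v t \<le> (1 + ?\<eta>) * v (Suc t)" by (simp add: algebra_simps)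
    also have "\<dots> \<le> exp ?\<eta> * v (Suc t)" by (intro mult_right_mono exp_ge_add_one_self) simp
    finally show ?thesis by (simp add: b_def)
  qed
  show "v (Suc t) \<le> exp (- (prob core - (K * e + 4 * (e + K * e)) * prob U)) * v t" if t: "t \<ge> 2 * n"
  proof -
    \<comment> \<open>Surviving \<open>s\<close> steps from time \<open>n\<close> on ends exactly at
      time \<open>t\<close>; \<open>t \<ge> 2 * n\<close> makes \<open>s \<ge> q\<close>.\<close>
    define s where "s = Suc t - n"
    have s: "s \<ge> q" "s + n - 1 = t" "s \<le> t" using t n by (auto simp: s_def)
    let ?E = "core \<inter> f -` survivors s"
    let ?\<kappa> = "prob core - (K * e + 4 * (e + K * e)) * b"
    \<comment> \<open>This factor \<open>b\<close> is what makes the error from early returns small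
      relative to \<open>prob U\<close>: it is multiplied below by \<open>e + K * e\<close>.\<close>
    have a_s: "a s \<le> 4 * b * v s"
    proof -
      have "a s \<le> 4 * b * v (Suc s)" using crude[of s] v_diff[OF s(1)] by (simp add: algebra_simps)
      also have "\<dots> \<le> 4 * b * v s"
        using b by (intro mult_left_mono finite_measure_mono survivors_mono survivors_sets) auto
      finally show ?thesis .
    qed
    have "prob (core \<inter> (f ^^ n) -` survivors s)
        \<le> prob ((core \<inter> f -` survivors t) \<union> (\<Union>j\<in>{R..<n}. core \<inter> (f ^^ j) -` ?E))"
      using core_split[OF s(1) n(2) R(1)] s(2)
      by (intro finite_measure_mono) (auto intro!: ev_sets sets.finite_UN)
    also have "\<dots> \<le> a t + prob (\<Union>j\<in>{R..<n}. core \<inter> (f ^^ j) -` ?E)"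
      by (intro measure_Un_le) (auto intro!: ev_sets sets.finite_UN)
    also have "prob (\<Union>j\<in>{R..<n}. core \<inter> (f ^^ j) -` ?E) \<le> (\<Sum>j\<in>{R..<n}. prob (core \<inter> (f ^^ j) -` ?E))"
      by (intro finite_measure_subadditive_finite) (auto intro!: ev_sets)
    also have "\<dots> \<le> (\<Sum>j\<in>{R..<n}. (b + K * \<gamma> j) * a s)"
    \<comment> \<open>Decay at lag \<open>j\<close> against \<open>?E\<close>, an event of
      probability \<open>a s\<close>. Summed over \<open>j\<close>, the product terms give at most
      \<open>n * b\<close> and the correlation terms the tail of \<open>\<gamma>\<close>.\<close>
    proof (rule sum_mono)
      fix j assume "j \<in> {R..<n}"
      then have "prob (core \<inter> (f ^^ j) -` ?E) \<le> (prob core + K * \<gamma> j) * a s"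
        using corr[of ?E j] R(2) by (simp add: ev_sets algebra_simps)
      also have "\<dots> \<le> (b + K * \<gamma> j) * a s" using core_le by (intro mult_right_mono) auto
      finally show "prob (core \<inter> (f ^^ j) -` ?E) \<le> (b + K * \<gamma> j) * a s" .
    qed
    also have "\<dots> = (real (n - R) * b + K * (\<Sum>j\<in>{R..<n}. \<gamma> j)) * a s"
      by (simp add: sum_distrib_right[symmetric] sum.distrib sum_distrib_left[symmetric])
    also have "\<dots> \<le> (e + K * e) * a s"
    proof (intro mult_right_mono add_mono mult_left_mono)
      have "real (n - R) * b \<le> real n * b" using b by (intro mult_right_mono) auto
      then show "real (n - R) * b \<le> e" using nb by (simp add: b_def)
    qed (use tail K in auto)
    also have "\<dots> \<le> (e + K * e) * (4 * b * v s)"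
    proof (intro mult_left_mono a_s)
      have "e \<ge> 0" using order.trans[OF _ nb] by simp
      then show "0 \<le> e + K * e" using K by simp
    qed
    finally have "prob (core \<inter> (f ^^ n) -` survivors s) \<le> a t + 4 * (e + K * e) * b * v s"
      by (simp add: algebra_simps)
    moreover have "prob core * v s - K * \<gamma> n * v s \<le> prob (core \<inter> (f ^^ n) -` survivors s)"
      using corr[OF survivors_sets n(2), of s] by simp
    moreover have "K * \<gamma> n * v s \<le> K * e * b * v s" using K\<gamma> by (intro mult_right_mono) auto
    ultimately have "?\<kappa> * v s \<le> a t" by (simp add: algebra_simps)
    \<comment> \<open>\<open>?\<kappa>\<close> may be negative; the bound by \<open>a t\<close> is
      then trivial, and otherwise \<open>v t \<le> v s\<close> applies.\<close>
    moreover have "?\<kappa> * v t \<le> max 0 (?\<kappa> * v s)"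
    proof (cases "?\<kappa> \<ge> 0")
      case True
      then have "?\<kappa> * v t \<le> ?\<kappa> * v s"
        using s(3) by (intro mult_left_mono finite_measure_mono survivors_mono survivors_sets)
      then show ?thesis by simp
    next
      case False
      then have "?\<kappa> * v t \<le> 0" by (intro mult_nonpos_nonneg) auto
      then show ?thesis by simp
    qed
    ultimately have "?\<kappa> * v t \<le> a t" using measure_nonneg[of M "core \<inter> f -` survivors t"] by linarith
    then have "v (Suc t) \<le> (1 - ?\<kappa>) * v t" using v_diff[of t] t n by (simp add: algebra_simps)
    also have "\<dots> \<le> exp (- ?\<kappa>) * v t"
    proof (rule mult_right_mono)
      show "1 - ?\<kappa> \<le> exp (- ?\<kappa>)" using exp_ge_add_one_self[of "- ?\<kappa>"] by linarith
    qed simp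
    finally show ?thesis by (simp add: b_def)
  qed
qed

section \<open>Passage to the limit of small balls\<close>

theorem corollary3p17:
  fixes atlas :: "('a::{t2_space, second_countable_topology}, 'e::euclidean_space) chart set"
    and g :: "('a, 'e) metric_tensor"
    and M :: "'a measure"
    and f :: "'a \<Rightarrow> 'a"
    and C :: "('a \<Rightarrow> real) set"
    and N :: "('a \<Rightarrow> real) \<Rightarrow> real"
    and \<gamma> :: "nat \<Rightarrow> real"
    and \<delta> K \<theta> :: real
    and \<zeta> :: 'a
    and q :: nat
    and B A :: "real \<Rightarrow> 'a set"
  assumes "riemannian_manifold atlas g"
    and "prob_space M" and "sets M = sets borel"
    and "f \<in> M \<rightarrow>\<^sub>M M" and "distr M M f = M"
    and "decay_of_correlations_against_L1 M f C N \<gamma>"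
    and "\<delta> > 0" and "(\<lambda>n. real n powr (1 + \<delta>) * \<gamma> n) \<longlonglongrightarrow> 0"
    and "B = riemannian_ball atlas g \<zeta>"
    and "regular_at M f B \<zeta>"
    and "\<exists>j. ((\<lambda>\<epsilon>. first_return f (annulus f (B \<epsilon>) j)) \<longlongrightarrow> \<infinity>) (at_right 0)"
    and "q = (LEAST j. ((\<lambda>\<epsilon>. first_return f (annulus f (B \<epsilon>) j)) \<longlongrightarrow> \<infinity>) (at_right 0))"
    and "A = (\<lambda>\<epsilon>. annulus f (B \<epsilon>) q)"
    and "K > 0" and "\<And>\<epsilon>. \<epsilon> > 0 \<Longrightarrow> indicator (A \<epsilon>) \<in> C \<and> N (indicator (A \<epsilon>)) \<le> K"
    and "((\<lambda>\<epsilon>. measure M (A \<epsilon>) / measure M (B \<epsilon>)) \<longlongrightarrow> \<theta>) (at_right 0)"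
  shows "\<exists>L :: ereal.
     ((\<lambda>\<epsilon>. ereal (1 / measure M (B \<epsilon>)) *
            Limsup at_top (\<lambda>t :: real. ereal (1 / t) *
              log_ereal (measure M {x \<in> space M. ereal_of_enat (hitting_time f (B \<epsilon>) x) > ereal t})))
        \<longlongrightarrow> L) (at_right 0)
     \<and> - L \<ge> ereal \<theta>"
proof -
  interpret prob_space M by fact
  have sp: "space M = UNIV" using sets_eq_imp_space_eq[OF assms(3)] by simp
  note dec = assms(6)
  define P where "P \<epsilon> = measure M (B \<epsilon>)" for \<epsilon>
  define H where "H \<epsilon> = Limsup at_top (\<lambda>t :: real. ereal (1 / t) *
      log_ereal (measure M {x \<in> space M. ereal_of_enat (hitting_time f (B \<epsilon>) x) > ereal t}))" for \<epsilon>
  note reg = assms(10)[unfolded regular_at_def]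
  have Ppos: "P \<epsilon> > 0" if "\<epsilon> > 0" for \<epsilon>
    using conjunct1[OF reg] that by (simp add: P_def)
  have P0: "(P \<longlongrightarrow> 0) (at_right 0)"
    unfolding P_def[abs_def] by (rule conjunct1[OF conjunct2[OF conjunct2[OF reg]]])
  have sys: "open_system M f (B \<epsilon>)" if "\<epsilon> > 0" for \<epsilon>
  proof unfold_locales
    \<comment> \<open>\<open>measure\<close> takes the value 0 on nonmeasurable sets, so positivity
      of \<open>P\<close> forces the ball to be measurable.\<close>
    show "B \<epsilon> \<in> sets M"
      using Ppos[OF that] measure_notin_sets[of "B \<epsilon>" M] unfolding P_def by force
  qed (use assms(4,5) sp in auto)
  have "((\<lambda>\<epsilon>. first_return f (annulus f (B \<epsilon>) q)) \<longlongrightarrow> \<infinity>) (at_right 0)"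
    unfolding assms(12) using assms(11) by (rule LeastI_ex)
  then have ret: "((\<lambda>\<epsilon>. first_return f (A \<epsilon>)) \<longlongrightarrow> \<infinity>) (at_right 0)" by (simp add: assms(13))
  have anti: "antimono_on {1..} \<gamma>" "\<gamma> \<longlonglongrightarrow> 0"
    using dec by (auto simp: decay_of_correlations_against_L1_def)
  note \<gamma> = nonneg_of_antimono_tendsto_0[OF anti]
  have ev: "\<forall>\<^sub>F n in sequentially. n \<ge> 1 \<and> real n powr (1 + \<delta>) * \<gamma> n < 1"
    using order_tendstoD(2)[OF assms(8) zero_less_one] eventually_ge_at_top[of 1] by eventually_elim auto
  \<comment> \<open>Summability controls the correlations at all returns beyond time
    \<open>R\<close>; the limit of \<open>n * \<gamma> n\<close> below yields the waiting
    time.\<close>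
  have summ: "summable \<gamma>"
  proof (rule summable_comparison_test_ev)
    show "\<forall>\<^sub>F n in sequentially. norm (\<gamma> n) \<le> real n powr (- (1 + \<delta>))"
      using ev
    proof eventually_elim
      case (elim n)
      then have "real n powr (1 + \<delta>) > 0" by simp
      then have "\<gamma> n \<le> inverse (real n powr (1 + \<delta>))" using elim by (simp add: field_simps)
      then show ?case using elim \<gamma>[of n] by (simp only: powr_minus real_norm_def abs_of_nonneg)
    qed
    show "summable (\<lambda>n. real n powr (- (1 + \<delta>)))" using assms(7) by (simp add: summable_real_powr_iff)
  qed
  have n\<gamma>: "(\<lambda>n. real n * \<gamma> n) \<longlonglongrightarrow> 0"
  proof (rule tendsto_sandwich[OF _ _ tendsto_const assms(8)])
    show "\<forall>\<^sub>F n in sequentially. 0 \<le> real n * \<gamma> n"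
      using eventually_ge_at_top[of 1] by eventually_elim (use \<gamma> in auto)
    show "\<forall>\<^sub>F n in sequentially. real n * \<gamma> n \<le> real n powr (1 + \<delta>) * \<gamma> n"
      using eventually_ge_at_top[of 1]
    proof eventually_elim
      case (elim n)
      have "real n powr 1 \<le> real n powr (1 + \<delta>)" using elim assms(7) by (intro powr_mono) auto
      then show ?case using elim \<gamma>[of n] by (intro mult_right_mono) auto
    qed
  qed
  \<comment> \<open>The two rates divided by \<open>P \<epsilon>\<close>, negated, with
    \<open>prob core / P \<epsilon>\<close> replaced by \<open>\<theta> + e\<close> and
    \<open>\<theta> - e\<close>.\<close>
  define lo hi where "lo e = - ((\<theta> + e + K * e) * exp (4 * e))"
    and "hi e = - (\<theta> - e - (K * e + 4 * (e + K * e)))" for e :: real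
  have lohi: "(lo \<longlongrightarrow> - \<theta>) (at_right 0)" "(hi \<longlongrightarrow> - \<theta>) (at_right 0)"
    unfolding lo_def hi_def by (rule tendsto_eq_intros refl | simp)+
  have bounds: "\<forall>\<^sub>F \<epsilon> in at_right 0. ereal (lo e) \<le> ereal (1 / P \<epsilon>) * H \<epsilon> \<and> ereal (1 / P \<epsilon>) * H \<epsilon> \<le> ereal (hi e)"
    if e: "0 < e" "e \<le> 1/8" "K * e \<le> 1" for e
  proof -
    \<comment> \<open>\<open>R\<close> depends on \<open>e\<close> alone; the divergence of the
      first return time makes it admissible for all small balls, whereas \<open>n\<close> depends on
      the ball.\<close>
    obtain R\<^sub>0 where R\<^sub>0: "\<And>m n. m \<ge> R\<^sub>0 \<Longrightarrow> norm (sum \<gamma> {m..<n}) < e"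
      using summ e(1) unfolding summable_Cauchy by blast
    define R where "R = max 1 R\<^sub>0"
    have tail: "(\<Sum>j\<in>{R..<n}. \<gamma> j) \<le> e" for n using R\<^sub>0[of R n] by (simp add: R_def)
    have "\<forall>\<^sub>F \<epsilon> in at_right 0. enat R < first_return f (A \<epsilon>)"
      using order_tendstoD(1)[OF ret, of "enat R"] by simp
    moreover have pos: "\<forall>\<^sub>F \<epsilon> in at_right 0. \<epsilon> > (0::real)" by (simp add: eventually_at_right_less)
    moreover have "\<forall>\<^sub>F \<epsilon> in at_right 0. \<exists>n\<ge>max 1 q. real n * P \<epsilon> \<le> e \<and> \<gamma> n \<le> e * P \<epsilon>"
      using pos Ppos e by (intro eventually_gap n\<gamma> P0) (auto elim: eventually_mono)
    moreover have "\<forall>\<^sub>F \<epsilon> in at_right 0. dist (measure M (A \<epsilon>) / P \<epsilon>) \<theta> < e"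
      using tendstoD[OF assms(16) e(1)] by (simp add: P_def)
    ultimately show ?thesis
    proof eventually_elim
      case (elim \<epsilon>)
      interpret open_system M f "B \<epsilon>" q using sys elim by simp
      have A: "A \<epsilon> = core" by (simp add: assms(13))
      have b: "P \<epsilon> > 0" using Ppos elim by simp
      from elim obtain n where n: "n \<ge> q" "n \<ge> 1" "real n * P \<epsilon> \<le> e" "\<gamma> n \<le> e * P \<epsilon>" by auto
      let ?\<eta> = "(prob core + K * e * P \<epsilon>) * exp (4 * e)"
      let ?\<kappa> = "prob core - (K * e + 4 * (e + K * e)) * P \<epsilon>"
      have C: "indicator core \<in> C" "N (indicator core) \<le> K" using assms(15)[of \<epsilon>] elim A by auto
      have ret': "enat R \<le> first_return f core" using elim A by simp
      have R1: "R \<ge> 1" by (simp add: R_def)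
      note rates = survivors_rates[OF dec C assms(14) b[unfolded P_def] ret' R1 tail n(1,2)
          n(3,4)[unfolded P_def] e(2,3), folded P_def]
      have H: "H \<epsilon> = Limsup at_top (\<lambda>t::real. ereal (1 / t) * log_ereal (v (nat \<lfloor>t\<rfloor>)))"
        unfolding H_def
      proof (rule Limsup_eq)
        show "\<forall>\<^sub>F t::real in at_top. ereal (1 / t) *
            log_ereal (measure M {x \<in> space M. ereal_of_enat (hitting_time f (B \<epsilon>) x) > ereal t})
          = ereal (1 / t) * log_ereal (v (nat \<lfloor>t\<rfloor>))"
          using eventually_ge_at_top[of "0::real"] by eventually_elim (simp only: hitting_time_gt)
      qed
      have HB: "ereal (- ?\<eta>) \<le> H \<epsilon>" "H \<epsilon> \<le> ereal (- ?\<kappa>)"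
        unfolding H by (rule Limsup_log_rate[where m = "2 * n" and \<eta> = ?\<eta> and \<kappa> = ?\<kappa>]; use rates in auto)+
      \<comment> \<open>Both bounds are finite, so the rest is real arithmetic.\<close>
      then obtain h where h: "H \<epsilon> = ereal h" by (cases "H \<epsilon>") auto
      have quo: "prob core / P \<epsilon> < \<theta> + e" "prob core / P \<epsilon> > \<theta> - e"
        using elim by (auto simp: A dist_real_def abs_less_iff)
      have "?\<eta> / P \<epsilon> = (prob core / P \<epsilon> + K * e) * exp (4 * e)"
        using b by (simp add: field_simps)
      also have "\<dots> \<le> - lo e" using quo by (simp add: lo_def)
      finally have "lo e \<le> - ?\<eta> / P \<epsilon>" by simp
      also have "\<dots> \<le> h / P \<epsilon>" using HB(1) b h by (intro divide_right_mono) auto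
      finally have 1: "lo e \<le> h / P \<epsilon>" .
      have "h / P \<epsilon> \<le> - ?\<kappa> / P \<epsilon>" using HB(2) b h by (intro divide_right_mono) auto
      also have "\<dots> = - (prob core / P \<epsilon> - (K * e + 4 * (e + K * e)))"
        using b by (simp add: field_simps)
      also have "\<dots> \<le> hi e" using quo by (simp add: hi_def)
      finally show ?case using 1 h by simp
    qed
  qed
  have small: "\<forall>\<^sub>F e in at_right 0. 0 < e \<and> e \<le> 1/8 \<and> K * e \<le> (1::real)"
    using assms(14) eventually_at_right_real[of 0 "min (1/8) (1/K)"]
    by (auto elim!: eventually_mono simp: field_simps)
  have "((\<lambda>\<epsilon>. ereal (1 / P \<epsilon>) * H \<epsilon>) \<longlongrightarrow> ereal (- \<theta>)) (at_right 0)"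
  \<comment> \<open>For given \<open>y\<close>, first fix \<open>e\<close> so that
    \<open>lo e\<close> or \<open>hi e\<close> lies on the right side of \<open>y\<close>; then
    \<open>bounds\<close> holds for all small radii.\<close>
  proof (rule order_tendstoI)
    fix y assume "y < ereal (- \<theta>)"
    with order_tendstoD(1)[OF tendsto_ereal[OF lohi(1)]] have "\<forall>\<^sub>F e in at_right 0. y < ereal (lo e)" by blast
    from eventually_happens[OF eventually_conj[OF this small]]
    obtain e where "y < ereal (lo e)" "0 < e" "e \<le> 1/8" "K * e \<le> 1" by auto
    with bounds[of e] show "\<forall>\<^sub>F \<epsilon> in at_right 0. y < ereal (1 / P \<epsilon>) * H \<epsilon>"
      by (auto elim!: eventually_mono intro: less_le_trans)
  next
    fix y assume "ereal (- \<theta>) < y"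
    with order_tendstoD(2)[OF tendsto_ereal[OF lohi(2)]] have "\<forall>\<^sub>F e in at_right 0. ereal (hi e) < y" by blast
    from eventually_happens[OF eventually_conj[OF this small]]
    obtain e where "ereal (hi e) < y" "0 < e" "e \<le> 1/8" "K * e \<le> 1" by auto
    with bounds[of e] show "\<forall>\<^sub>F \<epsilon> in at_right 0. ereal (1 / P \<epsilon>) * H \<epsilon> < y"
      by (auto elim!: eventually_mono intro: le_less_trans)
  qed
  then show ?thesis unfolding P_def H_def by (intro exI[of _ "ereal (- \<theta>)"]) simp
qed

end
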